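(* Let $0 \leq \alpha < n$ and let $p(\cdot) \in \mathcal{P}(\mathbb{R}^n)$ be such that $p_+<\frac{n}{\alpha}$; define $q(\cdot)$ by $\frac{1}{p(x)} - \frac{1}{q(x)} = \frac{\alpha}{n}$, $x\in\mathbb{R}^n$. Let $\mathcal{E}$ be a collection of measurable sets $E\subset\mathbb{R}^n$ with $0<|E|<\infty$. Then $p(\cdot) \in K_0^\alpha(\mathcal{E})$ if and only if the operators $A_E^\alpha$ satisfy $A_E^\alpha : L^{p(\cdot)}(\mathbb{R}^n) \to L^{q(\cdot)}(\mathbb{R}^n)$ and are uniformly bounded for all $E \in \mathcal{E}$. Moreover, the operator norms satisfy $$\sup_{E \in \mathcal{E}} \| A_E^\alpha \|_{L^{p(\cdot)} \rightarrow L^{q(\cdot)}} \leq K_{p(\cdot)} [\,p(\cdot)\,]_{K_0^\alpha(\mathcal{E})} \leq 4[\,p(\cdot)\,]_{K_0^\alpha(\mathcal{E})}.$$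
   Context: Conventions: $1/\infty = 0$, and $n/\alpha=\infty$ when $\alpha=0$. $\mathcal{P}(\mathbb{R}^n)$ is the set of Lebesgue measurable functions $p(\cdot):\mathbb{R}^n\to[1,\infty]$; $p_-$ and $p_+$ are the essential infimum and essential supremum of $p(\cdot)$ on $\mathbb{R}^n$. The conjugate exponent $p'(\cdot)$ is defined pointwise by $\frac1{p(x)}+\frac1{p'(x)}=1$. Let $\Omega_\infty=\{x\in\mathbb{R}^n:p(x)=\infty\}$, $\Omega_1=\{x\in\mathbb{R}^n:p(x)=1\}$, $\Omega_*=\{x\in\mathbb{R}^n:1<p(x)<\infty\}$. Modular: $\rho_{p(\cdot)}(f)=\int_{\mathbb{R}^n\setminus\Omega_\infty}|f(x)|^{p(x)}\,dx+\|f\|_{L^\infty(\Omega_\infty)}$. Norm: $\|f\|_{p(\cdot)}=\inf\{\lambda>0:\rho_{p(\cdot)}(f/\lambda)\le 1\}$. $L^{p(\cdot)}(\mathbb{R}^n)$ is the set of measurable $f$ with $\rho_{p(\cdot)}(f/\lambda)<\infty$ for some $\lambda>0$. $K_{p(\cdot)}=\left(\frac1{p_-}-\frac1{p_+}+1\right)\|\chi_{\Omega_*}\|_\infty+\|\chi_{\Omega_\infty}\|_\infty+\|\chi_{\Omega_1}\|_\infty$ (the constant in Hölder's inequality for variable Lebesgue spaces; $K_{p(\cdot)}\le4$). $[\,p(\cdot)\,]_{K_0^\alpha(\mathcal{E})}=\sup_{E\in\mathcal{E}}|E|^{\frac{\alpha}{n}-1}\|\chi_E\|_{p'(\cdot)}\|\chi_E\|_{q(\cdot)}$,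 and $p(\cdot)\in K_0^\alpha(\mathcal{E})$ means that this quantity is finite. Fractional averaging operator: $A_E^\alpha f(x)=|E|^{\frac{\alpha}{n}}\left(\frac1{|E|}\int_E f(y)\,dy\right)\chi_E(x)$. $\|T\|_{L^{p(\cdot)}\to L^{q(\cdot)}}$ is the infimum of the constants $C$ with $\|Tf\|_{q(\cdot)}\le C\|f\|_{p(\cdot)}$ for all $f\in L^{p(\cdot)}(\mathbb{R}^n)$. *)

theory Defs
  imports "HOL-Probability.Essential_Supremum"
begin

definition exponents :: "((real ^ 'n) \<Rightarrow> ennreal) set" where
  "exponents = {p \<in> borel_measurable lebesgue. \<forall>x. 1 \<le> p x}"

definition p_plus :: "((real ^ 'n) \<Rightarrow> ennreal) \<Rightarrow> ennreal" where
  "p_plus p = esssup lebesgue p"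

definition p_minus :: "((real ^ 'n) \<Rightarrow> ennreal) \<Rightarrow> ennreal" where
  "p_minus p = Sup {c. AE x in lebesgue. c \<le> p x}"

text \<open>For \<open>p x \<ge> 1\<close> this is the unique solution of the defining equation
  (lemma \<open>conj_exponent_eq\<close>); the subtraction is not truncated, and the
  endpoints come out right since \<open>1 / 0 = \<infinity>\<close> and \<open>1 / \<infinity> = 0\<close> in \<^typ>\<open>ennreal\<close>.\<close>

definition conj_exponent :: "((real ^ 'n) \<Rightarrow> ennreal) \<Rightarrow> (real ^ 'n) \<Rightarrow> ennreal" where
  "conj_exponent p x = 1 / (1 - 1 / p x)"

lemma conj_exponent_eq:
  assumes "1 \<le> p x"
  shows "1 / p x + 1 / conj_exponent p x = 1"
proof -
  have le: "inverse (p x) \<le> 1"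
    using assms by (cases "p x") (auto simp: ennreal_1[symmetric] inverse_ennreal field_simps simp del: ennreal_1)
  have inv: "inverse (inverse r) = r" for r :: ennreal
  proof (cases "r = 0 \<or> r = top")
    case False
    then show ?thesis
      by (cases r) (auto simp: inverse_ennreal)
  qed auto
  have "1 / conj_exponent p x = 1 - inverse (p x)"
    by (simp add: conj_exponent_def divide_ennreal_def inv)
  then show ?thesis
    using le by (simp add: divide_ennreal_def add_diff_inverse_ennreal)
qed

definition Linf_norm :: "((real ^ 'n) \<Rightarrow> real) \<Rightarrow> ennreal" where
  "Linf_norm f = esssup lebesgue (\<lambda>x. ennreal \<bar>f x\<bar>)"

text \<open>The norm of \<open>f\<close> in \<open>L\<^sup>\<infinity>\<close> of the set where \<open>p = \<infinity>\<close> is taken as the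
  \<open>L\<^sup>\<infinity>\<close> norm of \<open>f\<close> multiplied by the indicator of that set; it is \<open>0\<close> if the set is null.\<close>

definition modular :: "((real ^ 'n) \<Rightarrow> ennreal) \<Rightarrow> ((real ^ 'n) \<Rightarrow> real) \<Rightarrow> ennreal" where
  "modular p f =
     (\<integral>\<^sup>+x\<in>{x. p x \<noteq> \<infinity>}. ennreal (\<bar>f x\<bar> powr enn2real (p x)) \<partial>lebesgue)
     + Linf_norm (\<lambda>x. f x * indicator {x. p x = \<infinity>} x)"

definition Lp_norm :: "((real ^ 'n) \<Rightarrow> ennreal) \<Rightarrow> ((real ^ 'n) \<Rightarrow> real) \<Rightarrow> ennreal" where
  "Lp_norm p f = (INF l\<in>{l::real. 0 < l \<and> modular p (\<lambda>x. f x / l) \<le> 1}. ennreal l)"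

definition Lp_space :: "((real ^ 'n) \<Rightarrow> ennreal) \<Rightarrow> ((real ^ 'n) \<Rightarrow> real) set" where
  "Lp_space p =
     {f \<in> borel_measurable lebesgue. \<exists>l::real. 0 < l \<and> modular p (\<lambda>x. f x / l) < \<infinity>}"

definition holder_const :: "((real ^ 'n) \<Rightarrow> ennreal) \<Rightarrow> ennreal" where
  "holder_const p =
     (1 / p_minus p - 1 / p_plus p + 1) * Linf_norm (indicator {x. 1 < p x \<and> p x < \<infinity>})
     + Linf_norm (indicator {x. p x = \<infinity>})
     + Linf_norm (indicator {x. p x = 1})"

definition K0_const ::
  "real \<Rightarrow> (real ^ 'n) set set \<Rightarrow> ((real ^ 'n) \<Rightarrow> ennreal) \<Rightarrow> ((real ^ 'n) \<Rightarrow> ennreal) \<Rightarrow> ennreal" where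
  "K0_const \<alpha> \<E> p q =
     (SUP E\<in>\<E>. ennreal (measure lebesgue E powr (\<alpha> / real CARD('n) - 1))
        * Lp_norm (conj_exponent p) (indicator E) * Lp_norm q (indicator E))"

definition frac_avg ::
  "real \<Rightarrow> (real ^ 'n) set \<Rightarrow> ((real ^ 'n) \<Rightarrow> real) \<Rightarrow> (real ^ 'n) \<Rightarrow> real" where
  "frac_avg \<alpha> E f x =
     measure lebesgue E powr (\<alpha> / real CARD('n))
       * (1 / measure lebesgue E * set_lebesgue_integral lebesgue E f) * indicator E x"

text \<open>The Lebesgue integral is a total function, with value \<open>0\<close> on non-integrable
  functions. Hence the integrability of \<open>f\<close> on \<open>E\<close>, without which the average
  makes no sense, is part of the claim that the operator is defined on the whole space.\<close>

definition frac_avg_maps ::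
  "real \<Rightarrow> (real ^ 'n) set \<Rightarrow> ((real ^ 'n) \<Rightarrow> ennreal) \<Rightarrow> ((real ^ 'n) \<Rightarrow> ennreal) \<Rightarrow> bool" where
  "frac_avg_maps \<alpha> E p q \<longleftrightarrow>
     (\<forall>f\<in>Lp_space p. set_integrable lebesgue E f \<and> frac_avg \<alpha> E f \<in> Lp_space q)"

definition op_norm ::
  "((real ^ 'n) \<Rightarrow> ennreal) \<Rightarrow> ((real ^ 'n) \<Rightarrow> ennreal) \<Rightarrow>
     (((real ^ 'n) \<Rightarrow> real) \<Rightarrow> ((real ^ 'n) \<Rightarrow> real)) \<Rightarrow> ennreal" where
  "op_norm p q T = Inf {C. \<forall>f\<in>Lp_space p. Lp_norm q (T f) \<le> C * Lp_norm p f}"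

end

theory Submission
  imports Defs
begin

text \<open>For each \<open>E\<close> the operator is a rank one operator: \<open>A\<^sub>E f\<close> is \<open>|E|\<close> to the power \<open>\<alpha>/n - 1\<close>, times the integral
  of \<open>f\<close> over \<open>E\<close>, times the indicator of \<open>E\<close>. Its norm is therefore that power times the norm of the indicator
  in the target space times the norm of the functional \<open>f \<mapsto> \<integral>\<^sub>E f\<close> on the source space. So
  everything comes down to comparing the norm of this functional with the conjugate norm of the indicator.

  In one direction this is the inequality of Hoelder with the constant \<^const>\<open>holder_const\<close>
  (\<open>holder_Lp_norm\<close>), which gives the bound on the operator norms, and the integrability of \<open>f\<close> on \<open>E\<close>
  as well. The constant is at most \<open>4\<close>, as it is a sum of a term at most \<open>2\<close> and two terms at most \<open>1\<close>.

  In the other direction the functional has norm at least one third of the conjugate norm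
  (\<open>dual_test_function\<close>). For \<open>l\<close> below that norm the conjugate modular of the indicator divided by \<open>l\<close> exceeds \<open>1\<close>,
  so one of its three parts, over \<open>1 < p < \<infinity>\<close>, \<open>p = \<infinity>\<close> and \<open>p = 1\<close>, exceeds \<open>1/3\<close>. On the last
  two parts a normalised indicator is a test function. On the first one takes \<open>l\<close> to the power \<open>1 - p'(x)\<close>, as for a
  constant exponent, on a subset where \<open>p'\<close> is bounded, and divides by the modular if that is larger than \<open>1\<close>.
  A uniform bound \<open>C\<close> on the operators thus bounds \<^const>\<open>K0_const\<close> by \<open>3 C\<close>.\<close>

section \<open>The conjugate exponent\<close>

lemma ennreal_gt_1_finite_cases:
  assumes "1 < (c :: ennreal)" "c < \<infinity>"
  obtains P where "c = ennreal P" "1 < P"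
  using assms by (cases c) (auto simp: ennreal_1[symmetric] ennreal_less_iff simp del: ennreal_1)

lemma conj_exponent_at_1: "p x = 1 \<Longrightarrow> conj_exponent p x = \<infinity>"
  and conj_exponent_at_infinity: "p x = \<infinity> \<Longrightarrow> conj_exponent p x = 1"
  by (auto simp: conj_exponent_def)

lemma conj_exponent_between:
  assumes "1 < p x" "p x < \<infinity>"
  shows "conj_exponent p x = ennreal (enn2real (p x) / (enn2real (p x) - 1))"
proof -
  obtain P where P: "p x = ennreal P" "1 < P"
    using assms by (rule ennreal_gt_1_finite_cases)
  have "1 - 1 / p x = ennreal (1 - 1 / P)"
    using P by (simp add: ennreal_1[symmetric] divide_ennreal ennreal_minus del: ennreal_1)
  then have "conj_exponent p x = ennreal (1 / (1 - 1 / P))"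
    using P by (simp add: conj_exponent_def ennreal_1[symmetric] divide_ennreal del: ennreal_1)
  also have "1 / (1 - 1 / P) = P / (P - 1)"
    using P by (simp add: field_simps)
  finally show ?thesis using P by simp
qed

text \<open>Conjugation exchanges the sets where the exponent is \<open>1\<close> and \<open>\<infinity>\<close> and preserves the set
  where it lies strictly in between; all later case distinctions follow this pattern.\<close>

lemma conj_exponent_trichotomy:
  assumes "1 \<le> p x"
  obtains "p x = 1" "conj_exponent p x = \<infinity>" | "p x = \<infinity>" "conj_exponent p x = 1"
    | "1 < p x" "p x < \<infinity>" "1 < conj_exponent p x" "conj_exponent p x < \<infinity>"
proof -
  consider "p x = 1" | "p x = \<infinity>" | "1 < p x" "p x < \<infinity>"
    using assms by (metis infinity_ennreal_def order_le_less top.not_eq_extremum)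
  then show thesis
  proof cases
    case 3
    then obtain P where P: "p x = ennreal P" "1 < P"
      by (rule ennreal_gt_1_finite_cases)
    have "ennreal 1 < ennreal (P / (P - 1))"
      using P by (subst ennreal_less_iff) auto
    then show thesis
      using 3 P conj_exponent_between[of p x] that(3) by simp
  qed (use that conj_exponent_at_1[of p x] conj_exponent_at_infinity[of p x] in blast)+
qed

lemma conj_exponent_between_iff:
  "1 \<le> p x \<Longrightarrow> 1 < conj_exponent p x \<and> conj_exponent p x < \<infinity> \<longleftrightarrow> 1 < p x \<and> p x < \<infinity>"
  by (rule conj_exponent_trichotomy[of p x]) auto

lemma conj_exponent_eq_infinity_iff: "1 \<le> p x \<Longrightarrow> conj_exponent p x = \<infinity> \<longleftrightarrow> p x = 1"
  by (rule conj_exponent_trichotomy[of p x]) auto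

lemma conj_exponent_eq_1_iff: "1 \<le> p x \<Longrightarrow> conj_exponent p x = 1 \<longleftrightarrow> p x = \<infinity>"
  by (rule conj_exponent_trichotomy[of p x]) auto

lemma exponents_measurable: "p \<in> exponents \<Longrightarrow> p \<in> borel_measurable lebesgue"
  and exponents_ge_1: "p \<in> exponents \<Longrightarrow> 1 \<le> p x"
  by (auto simp: exponents_def)

lemma conj_exponent_exponents:
  assumes "p \<in> exponents"
  shows "conj_exponent p \<in> exponents"
proof -
  note [measurable] = exponents_measurable[OF assms]
  have "conj_exponent p \<in> borel_measurable lebesgue"
    unfolding conj_exponent_def[abs_def] by measurable
  moreover have "1 \<le> conj_exponent p x" for x
    by (rule conj_exponent_trichotomy[of p x, OF exponents_ge_1[OF assms]]) simp_all
  ultimately show ?thesis by (simp add: exponents_def)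
qed

section \<open>Essential bounds and the constant in the inequality of Hoelder\<close>

lemma AE_le_Linf_norm: "AE x in lebesgue. ennreal \<bar>f x\<bar> \<le> Linf_norm f"
  unfolding Linf_norm_def by (rule esssup_AE)

lemma Linf_norm_leI:
  assumes "f \<in> borel_measurable lebesgue" "AE x in lebesgue. ennreal \<bar>f x\<bar> \<le> c"
  shows "Linf_norm f \<le> c"
  unfolding Linf_norm_def using assms by (intro esssup_I) auto

lemma Linf_norm_indicator_le_1:
  "S \<in> sets lebesgue \<Longrightarrow> Linf_norm (indicator S) \<le> 1"
  by (rule Linf_norm_leI) (auto simp: indicator_def)

lemma Linf_norm_indicator_ge_1:
  fixes S :: "(real ^ 'n) set"
  assumes "\<not> (AE x in lebesgue. x \<notin> S)"
  shows "1 \<le> Linf_norm (indicator S)"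
proof (rule ccontr)
  assume lt: "\<not> 1 \<le> Linf_norm (indicator S)"
  have "AE x in lebesgue. x \<notin> S"
    using AE_le_Linf_norm[of "indicator S :: real ^ 'n \<Rightarrow> real"]
    by eventually_elim (use lt in \<open>auto simp: indicator_def split: if_splits\<close>)
  with assms show False by simp
qed

lemma exponents_level_sets [measurable]:
  assumes "p \<in> borel_measurable lebesgue"
  shows "{x. p x = (c :: ennreal)} \<in> sets lebesgue" "{x. p x \<noteq> c} \<in> sets lebesgue"
    "{x. a < p x \<and> p x < b} \<in> sets lebesgue"
  using measurable_sets[OF assms, of "{c}"] measurable_sets[OF assms, of "- {c}"]
    measurable_sets[OF assms, of "{a<..<b}"]
  by (auto simp: vimage_def greaterThanLessThan_def greaterThan_def lessThan_def)

lemma modular_bounds: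
  shows "(\<integral>\<^sup>+x\<in>{x. 1 < p x \<and> p x < \<infinity>}. ennreal (\<bar>f x\<bar> powr enn2real (p x)) \<partial>lebesgue) \<le> modular p f"
    and "(\<integral>\<^sup>+x\<in>{x. p x = 1}. ennreal \<bar>f x\<bar> \<partial>lebesgue) \<le> modular p f"
    and "AE x in lebesgue. p x = \<infinity> \<longrightarrow> ennreal \<bar>f x\<bar> \<le> modular p f"
proof -
  have le: "(\<integral>\<^sup>+x\<in>{x. p x \<noteq> \<infinity>}. ennreal (\<bar>f x\<bar> powr enn2real (p x)) \<partial>lebesgue) \<le> modular p f"
    and le': "Linf_norm (\<lambda>x. f x * indicator {x. p x = \<infinity>} x) \<le> modular p f"
    by (auto simp: modular_def)
  show "(\<integral>\<^sup>+x\<in>{x. 1 < p x \<and> p x < \<infinity>}. ennreal (\<bar>f x\<bar> powr enn2real (p x)) \<partial>lebesgue) \<le> modular p f"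
    by (rule order_trans[OF nn_integral_mono le]) (auto simp: indicator_def)
  show "(\<integral>\<^sup>+x\<in>{x. p x = 1}. ennreal \<bar>f x\<bar> \<partial>lebesgue) \<le> modular p f"
    by (rule order_trans[OF nn_integral_mono le]) (auto simp: indicator_def)
  show "AE x in lebesgue. p x = \<infinity> \<longrightarrow> ennreal \<bar>f x\<bar> \<le> modular p f"
    using AE_le_Linf_norm[of "\<lambda>x. f x * indicator {x. p x = \<infinity>} x"]
    by eventually_elim (use le' in auto)
qed

text \<open>The supremum defining \<^const>\<open>p_minus\<close> ranges over an uncountable set of almost everywhere lower
  bounds; it is attained along a sequence, and countably many null sets may be united.\<close>

lemma AE_p_minus_le: "AE x in lebesgue. p_minus p \<le> p x"
proof -
  let ?S = "{c. AE x in lebesgue. c \<le> p x}"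
  have ne: "?S \<noteq> {}" by (auto intro!: exI[of _ 0])
  obtain c :: "nat \<Rightarrow> ennreal" where c: "range c \<subseteq> ?S" "Sup ?S = (SUP n. c n)"
    using ennreal_Sup_countable_SUP[OF ne] by metis
  have "AE x in lebesgue. \<forall>n. c n \<le> p x"
    using c(1) by (subst AE_all_countable) auto
  then show ?thesis
    unfolding p_minus_def c(2) by eventually_elim (auto intro: SUP_least)
qed

lemma AE_le_p_plus: "AE x in lebesgue. p x \<le> p_plus p"
  unfolding p_plus_def by (rule esssup_AE)

lemma p_minus_ge_1: "p \<in> exponents \<Longrightarrow> 1 \<le> p_minus p"
  unfolding p_minus_def by (intro Sup_upper) (auto simp: exponents_ge_1)

lemma p_minus_le_p_plus: "p_minus (p :: real ^ 'n \<Rightarrow> ennreal) \<le> p_plus p"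
proof (rule ccontr)
  assume *: "\<not> p_minus p \<le> p_plus p"
  have "AE x in (lebesgue :: (real ^ 'n) measure). False"
    using AE_p_minus_le[of p] AE_le_p_plus[of p] by eventually_elim (use * in auto)
  then show False 
    by (simp add: trivial_limit_def[symmetric] ae_filter_eq_bot_iff)
qed

lemma holder_const_le_4:
  assumes "p \<in> exponents"
  shows "holder_const p \<le> 4"
proof -
  note [measurable] = exponents_measurable[OF assms]
  have "1 / p_minus p \<le> 1"
    using p_minus_ge_1[OF assms] by (intro divide_le_posI_ennreal) (auto intro: less_le_trans[OF zero_less_one])
  then have le: "1 / p_minus p - 1 / p_plus p + 1 \<le> 1 + 1"
    by (intro add_right_mono order_trans[OF diff_le_self_ennreal])
  have "holder_const p \<le> (1 + 1) * 1 + 1 + 1"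
    unfolding holder_const_def
    by (rule add_mono[OF add_mono[OF mult_mono[OF le]]]) (auto intro!: Linf_norm_indicator_le_1)
  then show ?thesis by simp
qed

section \<open>The inequality of Hoelder\<close>

lemma reciprocal_antimono_ennreal: "(a :: ennreal) \<le> b \<Longrightarrow> 1 / b \<le> 1 / a"
  by (simp add: divide_ennreal_def less_eq_ennreal.rep_eq inverse_ennreal.rep_eq ereal_inverse_antimono)

text \<open>The weights \<open>1/p(x)\<close> and \<open>1/p'(x) = 1 - 1/p(x)\<close> in the inequality of Young are replaced by constants
  so that the integral of the right-hand side can be estimated by the modulars. The two constants add up to
  the factor \<open>1/p\<^sub>- - 1/p\<^sub>+ + 1\<close> of \<^const>\<open>holder_const\<close>.\<close>

lemma Young_conj_exponent:
  assumes p: "1 < p x" "p x < \<infinity>"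
    and bounds: "p_minus p \<le> p x" "p x \<le> p_plus p"
    and "0 \<le> a" "0 \<le> b"
  shows "ennreal (a * b) \<le> 1 / p_minus p * ennreal (a powr enn2real (p x))
    + (1 - 1 / p_plus p) * ennreal (b powr enn2real (conj_exponent p x))"
proof -
  obtain P where P: "p x = ennreal P" "1 < P"
    using p by (rule ennreal_gt_1_finite_cases)
  define Q where "Q = P / (P - 1)"
  have Q: "1 < Q" "1 / P + 1 / Q = 1" "conj_exponent p x = ennreal Q"
    using P conj_exponent_between[of p x, OF p] by (auto simp: Q_def field_simps)
  have "a * b \<le> 1 / P * a powr P + 1 / Q * b powr Q"
    using Youngs_inequality[OF P(2) Q(1,2) \<open>0 \<le> a\<close> \<open>0 \<le> b\<close>] by simp
  then have "ennreal (a * b) \<le> ennreal (1 / P) * ennreal (a powr P) + ennreal (1 / Q) * ennreal (b powr Q)"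
    using P Q by (simp flip: ennreal_mult ennreal_plus)
  also have "ennreal (1 / P) = 1 / p x"
    using P by (simp add: ennreal_1[symmetric] divide_ennreal del: ennreal_1)
  also have "ennreal (1 / Q) = 1 - 1 / p x"
  proof -
    have "1 / Q = 1 - 1 / P" using Q(2) by simp
    then show ?thesis
      using P by (simp add: ennreal_1[symmetric] divide_ennreal ennreal_minus del: ennreal_1)
  qed
  also have "1 / p x * ennreal (a powr P) + (1 - 1 / p x) * ennreal (b powr Q)
      \<le> 1 / p_minus p * ennreal (a powr P) + (1 - 1 / p_plus p) * ennreal (b powr Q)"
    using bounds by (intro add_mono mult_right_mono ennreal_minus_mono reciprocal_antimono_ennreal) auto
  finally show ?thesis
    using P Q(1,3) by simp
qed

text \<open>The space is split into the parts where \<open>1 < p < \<infinity>\<close>, \<open>p = \<infinity>\<close> and \<open>p = 1\<close>. The first is handled by the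
  inequality of Young; on each of the other two, one factor is essentially bounded by \<open>1\<close> and the other has integral at
  most \<open>1\<close>. A null part contributes nothing, which accounts for the indicator norms
  in \<^const>\<open>holder_const\<close>.\<close>

lemma holder_modular:
  fixes p :: "real ^ 'n \<Rightarrow> ennreal"
  assumes p: "p \<in> exponents"
    and f[measurable]: "f \<in> borel_measurable lebesgue" and g[measurable]: "g \<in> borel_measurable lebesgue"
    and mf: "modular p f \<le> 1" and mg: "modular (conj_exponent p) g \<le> 1"
  shows "(\<integral>\<^sup>+x. ennreal \<bar>f x * g x\<bar> \<partial>lebesgue) \<le> holder_const p"
proof -
  note [measurable] = exponents_measurable[OF p] exponents_measurable[OF conj_exponent_exponents[OF p]]
  let ?h = "\<lambda>x. ennreal \<bar>f x * g x\<bar>"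
  let ?S = "{x. 1 < p x \<and> p x < \<infinity>}" and ?I = "{x. p x = \<infinity>}" and ?O = "{x. p x = 1}"
  have S': "{x. 1 < conj_exponent p x \<and> conj_exponent p x < \<infinity>} = ?S"
    and I': "{x. conj_exponent p x = 1} = ?I"
    and O': "conj_exponent p x = \<infinity> \<longleftrightarrow> p x = 1" for x
    using conj_exponent_between_iff[of p, OF exponents_ge_1[OF p]] conj_exponent_eq_1_iff[of p, OF exponents_ge_1[OF p]]
      conj_exponent_eq_infinity_iff[of p, OF exponents_ge_1[OF p]] by (simp_all only:)
  have split: "?h x = ?h x * indicator ?S x + ?h x * indicator ?I x + ?h x * indicator ?O x" for x
    by (rule conj_exponent_trichotomy[of p x, OF exponents_ge_1[OF p]]) (auto simp: indicator_def)
  have "(\<integral>\<^sup>+x. ?h x \<partial>lebesgue)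
      = (\<integral>\<^sup>+x. ?h x * indicator ?S x + ?h x * indicator ?I x + ?h x * indicator ?O x \<partial>lebesgue)"
    using split by (intro nn_integral_cong) simp
  also have "\<dots> = (\<integral>\<^sup>+x\<in>?S. ?h x \<partial>lebesgue) + (\<integral>\<^sup>+x\<in>?I. ?h x \<partial>lebesgue) + (\<integral>\<^sup>+x\<in>?O. ?h x \<partial>lebesgue)"
    by (simp add: nn_integral_add)
  also have "\<dots> \<le> (1 / p_minus p - 1 / p_plus p + 1) * Linf_norm (indicator ?S)
      + Linf_norm (indicator ?I) + Linf_norm (indicator ?O)"
  proof (intro add_mono)
    have null: "(\<integral>\<^sup>+x\<in>S. ?h x \<partial>lebesgue) = 0" if "AE x in lebesgue. x \<notin> S" for S
    proof -
      have "AE x in lebesgue. ?h x * indicator S x = 0"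
        using that by eventually_elim auto
      then have "(\<integral>\<^sup>+x\<in>S. ?h x \<partial>lebesgue) = (\<integral>\<^sup>+x. 0 \<partial>(lebesgue :: (real ^ 'n) measure))"
        by (rule nn_integral_cong_AE)
      then show ?thesis by simp
    qed
    have le_indicator: "(\<integral>\<^sup>+x\<in>S. ?h x \<partial>lebesgue) \<le> c * Linf_norm (indicator S)"
      if "(\<integral>\<^sup>+x\<in>S. ?h x \<partial>lebesgue) \<le> c" for S c
    proof (cases "AE x in lebesgue. x \<notin> S")
      case True
      then show ?thesis by (simp add: null)
    next
      case False
      have "c * 1 \<le> c * Linf_norm (indicator S)"
        using Linf_norm_indicator_ge_1[OF False] by (intro mult_left_mono) auto
      with that show ?thesis by simp
    qed
    show "(\<integral>\<^sup>+x\<in>?S. ?h x \<partial>lebesgue) \<le> (1 / p_minus p - 1 / p_plus p + 1) * Linf_norm (indicator ?S)"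
    proof (rule le_indicator)
      let ?F = "\<lambda>x. ennreal (\<bar>f x\<bar> powr enn2real (p x)) * indicator ?S x"
      let ?G = "\<lambda>x. ennreal (\<bar>g x\<bar> powr enn2real (conj_exponent p x)) * indicator ?S x"
      have "AE x in lebesgue. ?h x * indicator ?S x \<le> 1 / p_minus p * ?F x + (1 - 1 / p_plus p) * ?G x"
        using AE_p_minus_le[of p] AE_le_p_plus[of p]
        by eventually_elim
          (use Young_conj_exponent[of p _ "\<bar>f _\<bar>" "\<bar>g _\<bar>"] in \<open>auto simp: indicator_def abs_mult\<close>)
      then have "(\<integral>\<^sup>+x\<in>?S. ?h x \<partial>lebesgue) \<le> (\<integral>\<^sup>+x. 1 / p_minus p * ?F x + (1 - 1 / p_plus p) * ?G x \<partial>lebesgue)"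
        by (rule nn_integral_mono_AE)
      also have "\<dots> = 1 / p_minus p * (\<integral>\<^sup>+x. ?F x \<partial>lebesgue) + (1 - 1 / p_plus p) * (\<integral>\<^sup>+x. ?G x \<partial>lebesgue)"
        by (simp add: nn_integral_add nn_integral_cmult)
      also have "\<dots> \<le> 1 / p_minus p * 1 + (1 - 1 / p_plus p) * 1"
        using modular_bounds(1)[where p = p and f = f] modular_bounds(1)[where p = "conj_exponent p" and f = g] mf mg
        unfolding S' by (intro add_mono mult_left_mono) auto
      also have "\<dots> = 1 / p_minus p - 1 / p_plus p + 1"
      proof -
        \<comment> \<open>Both subtractions in the constant are proper, so they may be rearranged.\<close>
        have "1 \<le> p_plus p"
          using p_minus_ge_1[OF p] p_minus_le_p_plus[of p] by (rule order_trans)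
        then have "1 / p_plus p \<le> 1"
          by (intro divide_le_posI_ennreal) (auto intro: less_le_trans[OF zero_less_one])
        moreover have "1 / p_plus p \<le> 1 / p_minus p"
          by (intro reciprocal_antimono_ennreal p_minus_le_p_plus)
        ultimately show ?thesis
          by (simp add: diff_add_assoc2_ennreal add_diff_eq_ennreal)
      qed
      finally show "(\<integral>\<^sup>+x\<in>?S. ?h x \<partial>lebesgue) \<le> 1 / p_minus p - 1 / p_plus p + 1" .
    qed
    have "(\<integral>\<^sup>+x\<in>?I. ?h x \<partial>lebesgue) \<le> 1 * Linf_norm (indicator ?I)"
    proof (rule le_indicator)
      have "AE x in lebesgue. ?h x * indicator ?I x \<le> ennreal \<bar>g x\<bar> * indicator ?I x"
        using modular_bounds(3)[where p = p and f = f]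
      proof eventually_elim
        case (elim x)
        have "\<bar>f x\<bar> * \<bar>g x\<bar> \<le> 1 * \<bar>g x\<bar>" if "p x = \<infinity>"
          using that elim mf by (intro mult_right_mono) (auto intro: order_trans simp flip: ennreal_le_1)
        then show ?case by (auto simp: indicator_def abs_mult)
      qed
      then have "(\<integral>\<^sup>+x\<in>?I. ?h x \<partial>lebesgue) \<le> (\<integral>\<^sup>+x\<in>?I. ennreal \<bar>g x\<bar> \<partial>lebesgue)"
        by (rule nn_integral_mono_AE)
      also have "\<dots> \<le> 1"
        using modular_bounds(2)[where p = "conj_exponent p" and f = g] mg unfolding I' by simp
      finally show "(\<integral>\<^sup>+x\<in>?I. ?h x \<partial>lebesgue) \<le> 1" .
    qed
    then show "(\<integral>\<^sup>+x\<in>?I. ?h x \<partial>lebesgue) \<le> Linf_norm (indicator ?I)" by simp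
    have "(\<integral>\<^sup>+x\<in>?O. ?h x \<partial>lebesgue) \<le> 1 * Linf_norm (indicator ?O)"
    proof (rule le_indicator)
      have "AE x in lebesgue. ?h x * indicator ?O x \<le> ennreal \<bar>f x\<bar> * indicator ?O x"
        using modular_bounds(3)[where p = "conj_exponent p" and f = g]
      proof eventually_elim
        case (elim x)
        have "\<bar>f x\<bar> * \<bar>g x\<bar> \<le> \<bar>f x\<bar> * 1" if "p x = 1"
          using that elim mg O'[of x] by (intro mult_left_mono) (auto intro: order_trans simp flip: ennreal_le_1)
        then show ?case by (auto simp: indicator_def abs_mult)
      qed
      then have "(\<integral>\<^sup>+x\<in>?O. ?h x \<partial>lebesgue) \<le> (\<integral>\<^sup>+x\<in>?O. ennreal \<bar>f x\<bar> \<partial>lebesgue)"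
        by (rule nn_integral_mono_AE)
      also have "\<dots> \<le> 1"
        using modular_bounds(2)[where p = p and f = f] mf by simp
      finally show "(\<integral>\<^sup>+x\<in>?O. ?h x \<partial>lebesgue) \<le> 1" .
    qed
    then show "(\<integral>\<^sup>+x\<in>?O. ?h x \<partial>lebesgue) \<le> Linf_norm (indicator ?O)" by simp
  qed
  finally show ?thesis unfolding holder_const_def .
qed

section \<open>The Luxemburg norm\<close>

lemma modular_cong_abs:
  assumes "\<And>x. \<bar>f x\<bar> = \<bar>g x\<bar>"
  shows "modular r f = modular r g"
  by (simp add: modular_def Linf_norm_def abs_mult assms)

text \<open>Since \<open>p \<ge> 1\<close>, scaling by \<open>t \<le> 1\<close> gains at least a factor \<open>t\<close>. This is how a finite modular is turned into
  a modular at most \<open>1\<close>, so that functions of the space have finite norm.\<close>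

lemma modular_contract:
  assumes p: "p \<in> exponents" and f[measurable]: "f \<in> borel_measurable lebesgue" and t: "0 < t" "t \<le> 1"
  shows "modular p (\<lambda>x. t * f x) \<le> ennreal t * modular p f"
proof -
  note [measurable] = exponents_measurable[OF p]
  have pw: "ennreal (\<bar>t * f x\<bar> powr enn2real (p x)) * indicator {x. p x \<noteq> \<infinity>} x
      \<le> ennreal t * (ennreal (\<bar>f x\<bar> powr enn2real (p x)) * indicator {x. p x \<noteq> \<infinity>} x)" for x
  proof (cases "p x = \<infinity>")
    case False
    then obtain P where P: "p x = ennreal P" "0 \<le> P"
      by (cases "p x") auto
    then have "1 \<le> P"
      using exponents_ge_1[OF p, of x] by (simp add: ennreal_1[symmetric] del: ennreal_1)
    then have "t powr P * \<bar>f x\<bar> powr P \<le> t * \<bar>f x\<bar> powr P"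
      using t by (intro mult_right_mono powr_le_one_le) auto
    then have "\<bar>t * f x\<bar> powr P \<le> t * \<bar>f x\<bar> powr P"
      using t by (simp add: abs_mult powr_mult)
    then show ?thesis
      using P t by (simp flip: ennreal_mult)
  qed simp
  have "(\<integral>\<^sup>+x\<in>{x. p x \<noteq> \<infinity>}. ennreal (\<bar>t * f x\<bar> powr enn2real (p x)) \<partial>lebesgue)
     \<le> (\<integral>\<^sup>+x. ennreal t * (ennreal (\<bar>f x\<bar> powr enn2real (p x)) * indicator {x. p x \<noteq> \<infinity>} x) \<partial>lebesgue)"
    using pw by (intro nn_integral_mono)
  also have "\<dots> = ennreal t * (\<integral>\<^sup>+x\<in>{x. p x \<noteq> \<infinity>}. ennreal (\<bar>f x\<bar> powr enn2real (p x)) \<partial>lebesgue)"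
    by (rule nn_integral_cmult) measurable
  finally have 1: "(\<integral>\<^sup>+x\<in>{x. p x \<noteq> \<infinity>}. ennreal (\<bar>t * f x\<bar> powr enn2real (p x)) \<partial>lebesgue) \<le> \<dots>" .
  have 2: "Linf_norm (\<lambda>x. t * f x * indicator {x. p x = \<infinity>} x)
      \<le> ennreal t * Linf_norm (\<lambda>x. f x * indicator {x. p x = \<infinity>} x)"
  proof (rule Linf_norm_leI)
    show "AE x in lebesgue. ennreal \<bar>t * f x * indicator {x. p x = \<infinity>} x\<bar>
        \<le> ennreal t * Linf_norm (\<lambda>x. f x * indicator {x. p x = \<infinity>} x)"
      using AE_le_Linf_norm[of "\<lambda>x. f x * indicator {x. p x = \<infinity>} x"]
      by eventually_elim (use t in \<open>simp add: abs_mult ennreal_mult mult.assoc mult_left_mono\<close>)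
  qed measurable
  show ?thesis
    using add_mono[OF 1 2] by (simp add: modular_def distrib_left)
qed

lemma Lp_space_measurable: "f \<in> Lp_space r \<Longrightarrow> f \<in> borel_measurable lebesgue"
  by (simp add: Lp_space_def)

lemma Lp_space_normalisable:
  assumes p: "p \<in> exponents" and f: "f \<in> Lp_space p"
  shows "\<exists>l::real>0. modular p (\<lambda>x. f x / l) \<le> 1"
proof -
  obtain k where k: "0 < k" "modular p (\<lambda>x. f x / k) < \<infinity>"
    using f by (auto simp: Lp_space_def)
  then obtain m where m: "modular p (\<lambda>x. f x / k) = ennreal m" "0 \<le> m"
    by (cases "modular p (\<lambda>x. f x / k)") auto
  define c where "c = max 1 m"
  have c: "1 \<le> c" "m \<le> c" by (auto simp: c_def)
  have "modular p (\<lambda>x. 1 / c * (f x / k)) \<le> ennreal (1 / c) * modular p (\<lambda>x. f x / k)"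
    using c Lp_space_measurable[OF f] by (intro modular_contract[OF p]) auto
  also have "\<dots> = ennreal (m / c)"
    using m c by (simp flip: ennreal_mult)
  also have "\<dots> \<le> 1"
    using m c by (simp add: ennreal_1[symmetric] divide_le_eq del: ennreal_1)
  finally have "modular p (\<lambda>x. f x / (c * k)) \<le> 1"
    by simp
  with k c show ?thesis by (intro exI[of _ "c * k"]) auto
qed

lemma Lp_norm_leI: "0 < l \<Longrightarrow> modular r (\<lambda>x. f x / l) \<le> 1 \<Longrightarrow> Lp_norm r f \<le> ennreal l"
  unfolding Lp_norm_def by (intro INF_lower) auto

lemma Lp_norm_finite:
  assumes "p \<in> exponents" "f \<in> Lp_space p"
  shows "Lp_norm p f < \<infinity>"
proof -
  obtain l :: real where "0 < l" "modular p (\<lambda>x. f x / l) \<le> 1"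
    using Lp_space_normalisable[OF assms] by auto
  then show ?thesis
    using Lp_norm_leI[of l p f] ennreal_less_top[of l] by (simp add: order_le_less_trans)
qed

lemma Lp_norm_0: "Lp_norm r (\<lambda>x. 0) = 0"
proof -
  have "Lp_norm r (\<lambda>x. 0) \<le> ennreal e" if "0 < e" for e
    using that by (intro Lp_norm_leI) (auto simp: modular_def Linf_norm_def esssup_const)
  then show ?thesis
    using ennreal_le_epsilon[of 0 "Lp_norm r (\<lambda>x. 0)"] by simp
qed

text \<open>Inequalities on norms are obtained from one inequality for each admissible scaling factor;
  this passes to the infimum over the factors. The index set has to be nonempty because
  \<open>0 * \<infinity> = 0\<close>, and \<open>c\<close> has to be finite for the same reason.\<close>

lemma le_mult_INF_ennreal:
  fixes X c :: ennreal
  assumes "c < \<infinity>" and "A \<noteq> {}" and le: "\<And>i. i \<in> A \<Longrightarrow> X \<le> c * f i"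
  shows "X \<le> c * (INF i\<in>A. f i)"
proof (cases "c = 0")
  case True
  then show ?thesis using assms by auto
next
  case False
  have "X \<le> c * y \<longleftrightarrow> X / c \<le> y" for y
  proof -
    have "X / c \<le> y" if "X \<le> c * y"
      using divide_right_mono_ennreal[OF that, of c] False \<open>c < \<infinity>\<close>
      by (simp add: ennreal_mult_divide_eq mult.commute[of c])
    moreover have "X \<le> c * y" if "X / c \<le> y"
      using mult_left_mono[OF that, of c] False \<open>c < \<infinity>\<close>
      by (simp add: ennreal_times_divide ennreal_mult_divide_eq mult.commute)
    ultimately show ?thesis by blast
  qed
  with le show ?thesis by (auto intro!: INF_greatest)
qed

lemma Lp_norm_cmult_le:
  assumes "c \<noteq> 0"
  shows "Lp_norm r (\<lambda>x. c * f x) \<le> ennreal \<bar>c\<bar> * Lp_norm r f"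
proof (cases "{l::real. 0 < l \<and> modular r (\<lambda>x. f x / l) \<le> 1} = {}")
  case True
  then have "Lp_norm r f = \<infinity>"
    by (simp add: Lp_norm_def del: Collect_empty_eq)
  then show ?thesis using assms by (simp add: ennreal_mult_top)
next
  case False
  show ?thesis
    unfolding Lp_norm_def[of r f]
  proof (rule le_mult_INF_ennreal[OF _ False])
    fix l :: real assume l: "l \<in> {l. 0 < l \<and> modular r (\<lambda>x. f x / l) \<le> 1}"
    have "modular r (\<lambda>x. c * f x / (\<bar>c\<bar> * l)) = modular r (\<lambda>x. f x / l)"
      using assms by (intro modular_cong_abs) (auto simp: abs_mult)
    with l assms have "Lp_norm r (\<lambda>x. c * f x) \<le> ennreal (\<bar>c\<bar> * l)"
      by (intro Lp_norm_leI) auto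
    then show "Lp_norm r (\<lambda>x. c * f x) \<le> ennreal \<bar>c\<bar> * ennreal l"
      using l by (simp add: ennreal_mult)
  qed simp
qed

text \<open>The upper estimate applied to the factors \<open>c\<close> and \<open>1/c\<close> gives equality.\<close>

lemma Lp_norm_cmult: "Lp_norm r (\<lambda>x. c * f x) = ennreal \<bar>c\<bar> * Lp_norm r f"
proof (cases "c = 0")
  case True
  then show ?thesis by (simp add: Lp_norm_0)
next
  case False
  have "ennreal \<bar>c\<bar> * Lp_norm r f \<le> ennreal \<bar>c\<bar> * (ennreal \<bar>1 / c\<bar> * Lp_norm r (\<lambda>x. c * f x))"
    using Lp_norm_cmult_le[of "1 / c" r "\<lambda>x. c * f x"] False by (intro mult_left_mono) auto
  also have "\<dots> = Lp_norm r (\<lambda>x. c * f x)"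
    using False by (simp add: mult.assoc[symmetric] abs_mult[symmetric] flip: ennreal_mult)
  finally show ?thesis
    using Lp_norm_cmult_le[OF False, of r f] by (intro antisym)
qed

text \<open>Indicators of sets of finite measure belong to every variable Lebesgue space, even for an unbounded exponent:
  values at most \<open>1\<close> do not grow when raised to any power.\<close>

lemma modular_le_emeasure:
  assumes [measurable]: "E \<in> sets lebesgue" "{x. r x = \<infinity>} \<in> sets lebesgue" "f \<in> borel_measurable lebesgue"
    and f: "\<And>x. \<bar>f x\<bar> \<le> indicator E x"
  shows "modular r f \<le> emeasure lebesgue E + 1"
proof -
  have le1: "\<bar>f x\<bar> \<le> 1" for x
    using f[of x] by (cases "x \<in> E") auto
  have "ennreal (\<bar>f x\<bar> powr enn2real (r x)) * indicator {x. r x \<noteq> \<infinity>} x \<le> indicator E x" for x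
  proof (cases "x \<in> E")
    case True
    then have "ennreal (\<bar>f x\<bar> powr enn2real (r x)) \<le> 1"
      using le1[of x] by (simp add: powr_le1)
    with True show ?thesis by (simp add: indicator_def)
  next
    case False
    then have "f x = 0" using f[of x] by simp
    with False show ?thesis by simp
  qed
  then have "(\<integral>\<^sup>+x\<in>{x. r x \<noteq> \<infinity>}. ennreal (\<bar>f x\<bar> powr enn2real (r x)) \<partial>lebesgue) \<le> (\<integral>\<^sup>+x. indicator E x \<partial>lebesgue)"
    by (rule nn_integral_mono)
  moreover have "Linf_norm (\<lambda>x. f x * indicator {x. r x = \<infinity>} x) \<le> 1"
  proof (rule Linf_norm_leI)
    show "(\<lambda>x. f x * indicator {x. r x = \<infinity>} x) \<in> borel_measurable lebesgue"
      by measurable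
    show "AE x in lebesgue. ennreal \<bar>f x * indicator {x. r x = \<infinity>} x\<bar> \<le> 1"
      using le1 by (auto simp: indicator_def)
  qed
  ultimately show ?thesis
    by (simp add: modular_def add_mono)
qed

lemma cmult_indicator_Lp_space:
  assumes [measurable]: "E \<in> sets lebesgue" "{x. r x = \<infinity>} \<in> sets lebesgue"
    and "emeasure lebesgue E < \<infinity>"
  shows "(\<lambda>x. c * indicator E x) \<in> Lp_space r"
proof -
  let ?l = "max 1 \<bar>c\<bar>"
  have "modular r (\<lambda>x. c * indicator E x / ?l) \<le> emeasure lebesgue E + 1"
    by (rule modular_le_emeasure[OF assms(1,2)]) (auto simp: indicator_def)
  also have "\<dots> < \<infinity>" using assms by simp
  finally have "0 < ?l \<and> modular r (\<lambda>x. c * indicator E x / ?l) < \<infinity>" by simp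
  then show ?thesis
    unfolding Lp_space_def mem_Collect_eq by (intro conjI exI[of _ ?l]) measurable
qed

text \<open>Normalise both functions by admissible factors, and take the infimum over one factor after the other.\<close>

lemma holder_Lp_norm:
  assumes p: "p \<in> exponents" and f: "f \<in> Lp_space p" and g: "g \<in> Lp_space (conj_exponent p)"
  shows "(\<integral>\<^sup>+x. ennreal \<bar>f x * g x\<bar> \<partial>lebesgue) \<le> holder_const p * Lp_norm p f * Lp_norm (conj_exponent p) g"
proof -
  note p' = conj_exponent_exponents[OF p]
  note [measurable] = Lp_space_measurable[OF f] Lp_space_measurable[OF g]
  let ?A = "{l::real. 0 < l \<and> modular p (\<lambda>x. f x / l) \<le> 1}"
  let ?B = "{l::real. 0 < l \<and> modular (conj_exponent p) (\<lambda>x. g x / l) \<le> 1}"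
  have ne: "?A \<noteq> {}" "?B \<noteq> {}"
    using Lp_space_normalisable[OF p f] Lp_space_normalisable[OF p' g] by simp_all
  have K: "holder_const p < \<infinity>"
    using holder_const_le_4[OF p] by (auto simp: order_le_less_trans)
  have *: "(\<integral>\<^sup>+x. ennreal \<bar>f x * g x\<bar> \<partial>lebesgue) \<le> holder_const p * ennreal l * ennreal m"
    if l: "l \<in> ?A" and m: "m \<in> ?B" for l m
  proof -
    have "(\<integral>\<^sup>+x. ennreal \<bar>f x * g x\<bar> \<partial>lebesgue)
        = (\<integral>\<^sup>+x. ennreal (l * m) * ennreal \<bar>f x / l * (g x / m)\<bar> \<partial>lebesgue)"
      using l m by (intro nn_integral_cong) (simp add: abs_mult flip: ennreal_mult)
    also have "\<dots> = ennreal (l * m) * (\<integral>\<^sup>+x. ennreal \<bar>f x / l * (g x / m)\<bar> \<partial>lebesgue)"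
      by (rule nn_integral_cmult) measurable
    also have "\<dots> \<le> ennreal (l * m) * holder_const p"
      using l m by (intro mult_left_mono holder_modular[OF p]) auto
    finally show ?thesis
      using l m by (simp add: ennreal_mult mult_ac)
  qed
  have "(\<integral>\<^sup>+x. ennreal \<bar>f x * g x\<bar> \<partial>lebesgue) \<le> holder_const p * Lp_norm (conj_exponent p) g * Lp_norm p f"
    unfolding Lp_norm_def[of p f]
  proof (rule le_mult_INF_ennreal[OF _ ne(1)])
    show "holder_const p * Lp_norm (conj_exponent p) g < \<infinity>"
      using K Lp_norm_finite[OF p' g] by (simp add: ennreal_mult_less_top)
    fix l assume l: "l \<in> ?A"
    have "(\<integral>\<^sup>+x. ennreal \<bar>f x * g x\<bar> \<partial>lebesgue) \<le> holder_const p * ennreal l * Lp_norm (conj_exponent p) g"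
      unfolding Lp_norm_def
      by (rule le_mult_INF_ennreal[OF _ ne(2) *[OF l]]) (use K in \<open>simp add: ennreal_mult_less_top\<close>)
    then show "(\<integral>\<^sup>+x. ennreal \<bar>f x * g x\<bar> \<partial>lebesgue) \<le> holder_const p * Lp_norm (conj_exponent p) g * ennreal l"
      by (simp add: mult_ac)
  qed
  then show ?thesis by (simp add: mult_ac)
qed

section \<open>Test functions for the conjugate norm of an indicator\<close>

text \<open>With conjugate exponent \<open>P' = P/(P - 1)\<close> one has \<open>(1 - P') P = -P'\<close>, so the \<open>P\<close>-th power of
  \<open>l\<close> to the power \<open>1 - P'\<close> is the integrand of the conjugate modular of \<open>1/l\<close>. A divisor \<open>t \<ge> 1\<close> may be moved
  out of the power at the cost of an inequality.\<close>

lemma dual_exponent_power: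
  fixes P l t :: real
  assumes "1 < P" "0 < l" "1 \<le> t"
  shows "(l powr (1 - P / (P - 1)) / t) powr P \<le> (1 / l) powr (P / (P - 1)) / t"
proof -
  have "(1 - P / (P - 1)) * P = - (P / (P - 1))"
    using assms by (simp add: field_simps)
  then have "(l powr (1 - P / (P - 1)) / t) powr P = l powr (- (P / (P - 1))) / t powr P"
    using assms by (simp add: powr_divide powr_powr)
  also have "\<dots> \<le> l powr (- (P / (P - 1))) / t"
    using assms powr_mono[of 1 P t] by (intro divide_left_mono) auto
  also have "l powr (- (P / (P - 1))) = (1 / l) powr (P / (P - 1))"
    using assms by (simp add: powr_divide powr_minus_divide)
  finally show ?thesis .
qed

text \<open>If \<open>l < 1\<close> and the conjugate exponent is unbounded, its modular may be infinite, and then it cannot be used to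
  normalise a test function. The sets where the exponent is at most \<open>N\<close> exhaust \<open>A\<close>, so by monotone
  convergence one of them already has integral above \<open>c\<close>; there the integrand is bounded.\<close>

lemma truncate_conj_exponent:
  fixes p' :: "real ^ 'n \<Rightarrow> ennreal" and l :: real
  assumes [measurable]: "p' \<in> borel_measurable lebesgue" "A \<in> sets lebesgue"
    and A: "emeasure lebesgue A < \<infinity>" "\<And>x. x \<in> A \<Longrightarrow> p' x < \<infinity>"
    and l: "0 < l"
    and c: "c < (\<integral>\<^sup>+x\<in>A. ennreal ((1 / l) powr enn2real (p' x)) \<partial>lebesgue)"
  obtains F where "F \<in> sets lebesgue" "F \<subseteq> A"
    "c < (\<integral>\<^sup>+x\<in>F. ennreal ((1 / l) powr enn2real (p' x)) \<partial>lebesgue)"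
    "(\<integral>\<^sup>+x\<in>F. ennreal ((1 / l) powr enn2real (p' x)) \<partial>lebesgue) < \<infinity>"
proof -
  let ?h = "\<lambda>x. ennreal ((1 / l) powr enn2real (p' x))"
  define F where "F N = {x \<in> A. enn2real (p' x) \<le> real N}" for N
  have F_eq: "F N = A \<inter> {x \<in> space lebesgue. enn2real (p' x) \<le> real N}" for N
    by (auto simp: F_def)
  have F[measurable]: "F N \<in> sets lebesgue" for N
    unfolding F_eq by measurable
  have "(\<integral>\<^sup>+x\<in>A. ?h x \<partial>lebesgue) = (\<integral>\<^sup>+x. (SUP N. ?h x * indicator (F N) x) \<partial>lebesgue)"
  proof (rule nn_integral_cong)
    fix x :: "real ^ 'n"
    have "(SUP N. indicator (F N) x :: ennreal) = indicator A x"
    proof (cases "x \<in> A")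
      case True
      obtain N where "enn2real (p' x) \<le> real N"
        using real_arch_simple by blast
      with True have "indicator A x \<le> (indicator (F N) x :: ennreal)"
        by (simp add: F_def)
      then show ?thesis
        by (intro antisym SUP_least SUP_upper2[of N]) (auto simp: F_def indicator_def)
    qed (auto simp: F_def indicator_def)
    then show "?h x * indicator A x = (SUP N. ?h x * indicator (F N) x)"
      by (simp add: SUP_mult_left_ennreal[symmetric])
  qed
  also have "\<dots> = (SUP N. \<integral>\<^sup>+x\<in>F N. ?h x \<partial>lebesgue)"
  proof (rule nn_integral_monotone_convergence_SUP)
    show "incseq (\<lambda>N x. ?h x * indicator (F N) x)"
      by (auto simp: incseq_def le_fun_def F_def indicator_def)
  qed measurable
  finally obtain N where N: "c < (\<integral>\<^sup>+x\<in>F N. ?h x \<partial>lebesgue)"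
    using c by (auto simp: less_SUP_iff)
  have "?h x * indicator (F N) x \<le> ennreal (max 1 (1 / l) powr real N) * indicator A x" for x
  proof (cases "x \<in> F N")
    case True
    have "(1 / l) powr enn2real (p' x) \<le> max 1 (1 / l) powr enn2real (p' x)"
      using l by (intro powr_mono2) auto
    also have "\<dots> \<le> max 1 (1 / l) powr real N"
      using True by (intro powr_mono) (auto simp: F_def)
    finally show ?thesis
      using True by (auto simp: F_def intro: ennreal_leI)
  qed simp
  then have "(\<integral>\<^sup>+x\<in>F N. ?h x \<partial>lebesgue) \<le> (\<integral>\<^sup>+x. ennreal (max 1 (1 / l) powr real N) * indicator A x \<partial>lebesgue)"
    by (rule nn_integral_mono)
  also have "\<dots> = ennreal (max 1 (1 / l) powr real N) * emeasure lebesgue A"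
    by (rule nn_integral_cmult_indicator) measurable
  also have "\<dots> < \<infinity>"
    using A by (simp add: ennreal_mult_less_top)
  finally show thesis
    using N by (intro that[of "F N"]) (auto simp: F_def)
qed

text \<open>The three terms belong to the sets where \<open>p\<close> is strictly between \<open>1\<close> and \<open>\<infinity>\<close>, equal to \<open>\<infinity>\<close> and equal to \<open>1\<close>;
  the conjugate exponent is finite and greater than \<open>1\<close>, equal to \<open>1\<close> and equal to \<open>\<infinity>\<close> there.\<close>

lemma modular_conj_indicator_le:
  fixes p :: "real ^ 'n \<Rightarrow> ennreal" and l :: real
  assumes p: "p \<in> exponents" and E[measurable]: "E \<in> sets lebesgue" and l: "0 < l"
  shows "modular (conj_exponent p) (\<lambda>x. indicator E x / l)
    \<le> (\<integral>\<^sup>+x\<in>E \<inter> {x. 1 < p x \<and> p x < \<infinity>}. ennreal ((1 / l) powr enn2real (conj_exponent p x)) \<partial>lebesgue)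
      + ennreal (1 / l) * emeasure lebesgue (E \<inter> {x. p x = \<infinity>})
      + Linf_norm (\<lambda>x. indicator (E \<inter> {x. p x = 1}) x / l)"
proof -
  note [measurable] = exponents_measurable[OF p] exponents_measurable[OF conj_exponent_exponents[OF p]]
  let ?S = "E \<inter> {x. 1 < p x \<and> p x < \<infinity>}" and ?I = "E \<inter> {x. p x = \<infinity>}" and ?O = "E \<inter> {x. p x = 1}"
  let ?h = "\<lambda>x. ennreal ((1 / l) powr enn2real (conj_exponent p x))"
  have pw: "ennreal (\<bar>indicator E x / l\<bar> powr enn2real (conj_exponent p x)) * indicator {x. conj_exponent p x \<noteq> \<infinity>} x
      \<le> ?h x * indicator ?S x + ennreal (1 / l) * indicator ?I x" for x
  proof (cases "x \<in> E")
    case True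
    show ?thesis
      by (rule conj_exponent_trichotomy[of p x, OF exponents_ge_1[OF p]])
        (use True l in \<open>simp_all add: indicator_def\<close>)
  qed simp
  have "(\<integral>\<^sup>+x\<in>{x. conj_exponent p x \<noteq> \<infinity>}. ennreal (\<bar>indicator E x / l\<bar> powr enn2real (conj_exponent p x)) \<partial>lebesgue)
      \<le> (\<integral>\<^sup>+x. ?h x * indicator ?S x + ennreal (1 / l) * indicator ?I x \<partial>lebesgue)"
    by (rule nn_integral_mono) (rule pw)
  also have "\<dots> = (\<integral>\<^sup>+x\<in>?S. ?h x \<partial>lebesgue) + ennreal (1 / l) * emeasure lebesgue ?I"
    by (simp add: nn_integral_add nn_integral_cmult_indicator)
  finally have "(\<integral>\<^sup>+x\<in>{x. conj_exponent p x \<noteq> \<infinity>}. ennreal (\<bar>indicator E x / l\<bar> powr enn2real (conj_exponent p x)) \<partial>lebesgue)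
      \<le> \<dots>" .
  moreover have "(\<lambda>x. indicator E x / l * indicator {x. conj_exponent p x = \<infinity>} x) = (\<lambda>x. indicator ?O x / l)"
    using conj_exponent_eq_infinity_iff[of p, OF exponents_ge_1[OF p]] by (auto simp: indicator_def fun_eq_iff)
  ultimately show ?thesis
    unfolding modular_def by (simp add: add_right_mono)
qed

text \<open>This is the converse of the inequality of Hoelder for indicators, with loss of a factor \<open>3\<close>: a number \<open>l\<close>
  with conjugate modular above \<open>1\<close> does not exceed the norm of the indicator, and \<open>f\<close> in the unit ball nearly
  realises \<open>l\<close> as an integral over \<open>E\<close>. One of the three parts of the modular exceeds \<open>1/3\<close>, and
  it suffices to test on that part, where the classical extremal functions are available.\<close>

lemma dual_test_function:
  fixes p :: "real ^ 'n \<Rightarrow> ennreal" and l :: real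
  assumes p: "p \<in> exponents" and E[measurable]: "E \<in> sets lebesgue" and fin: "emeasure lebesgue E < \<infinity>"
    and l: "0 < l" and gt: "\<not> modular (conj_exponent p) (\<lambda>x. indicator E x / l) \<le> 1"
  shows "\<exists>f \<in> borel_measurable lebesgue. (\<forall>x. 0 \<le> f x) \<and> modular p f \<le> 1 \<and>
    ennreal (l / 3) \<le> (\<integral>\<^sup>+x\<in>E. ennreal (f x) \<partial>lebesgue)"
proof -
  note [measurable] = exponents_measurable[OF p] exponents_measurable[OF conj_exponent_exponents[OF p]]
  let ?S = "E \<inter> {x. 1 < p x \<and> p x < \<infinity>}" and ?I = "E \<inter> {x. p x = \<infinity>}" and ?O = "E \<inter> {x. p x = 1}"
  let ?h = "\<lambda>x. ennreal ((1 / l) powr enn2real (conj_exponent p x))"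
  let ?a = "\<integral>\<^sup>+x\<in>?S. ?h x \<partial>lebesgue" and ?b = "ennreal (1 / l) * emeasure lebesgue ?I"
    and ?c = "Linf_norm (\<lambda>x. indicator ?O x / l)"
  have finite_part: "emeasure lebesgue (E \<inter> A) < \<infinity>" if "A \<in> sets lebesgue" for A
    using that fin by (meson E emeasure_mono inf_le1 order_le_less_trans)
  have "\<not> (?a \<le> ennreal (1/3) \<and> ?b \<le> ennreal (1/3) \<and> ?c \<le> ennreal (1/3))"
  proof
    assume "?a \<le> ennreal (1/3) \<and> ?b \<le> ennreal (1/3) \<and> ?c \<le> ennreal (1/3)"
    then have "?a + ?b + ?c \<le> ennreal (1/3) + ennreal (1/3) + ennreal (1/3)"
      by (intro add_mono) auto
    also have "\<dots> = 1"
      by (simp flip: ennreal_plus)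
    finally show False
      using gt modular_conj_indicator_le[OF p E l] order_trans by blast
  qed
  then consider "ennreal (1/3) < ?a" | "ennreal (1/3) < ?b" | "ennreal (1/3) < ?c"
    by (meson not_less)
  then show ?thesis
  proof cases
    case 1
    have S': "{x. 1 < p x \<and> p x < \<infinity>} \<in> sets lebesgue" by measurable
    then have S: "?S \<in> sets lebesgue" using E by simp
    have p'_fin: "conj_exponent p x < \<infinity>" if "x \<in> ?S" for x
      by (rule conj_exponent_trichotomy[of p x, OF exponents_ge_1[OF p]]) (use that in auto)
    obtain F where F[measurable]: "F \<in> sets lebesgue" and FS: "F \<subseteq> ?S"
      and gt: "ennreal (1/3) < (\<integral>\<^sup>+x\<in>F. ?h x \<partial>lebesgue)" and lt: "(\<integral>\<^sup>+x\<in>F. ?h x \<partial>lebesgue) < \<infinity>"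
      by (rule truncate_conj_exponent[OF exponents_measurable[OF conj_exponent_exponents[OF p]] S
        finite_part[OF S'] p'_fin l 1])
    obtain m where m: "(\<integral>\<^sup>+x\<in>F. ?h x \<partial>lebesgue) = ennreal m" "1/3 < m"
      using gt lt by (cases "\<integral>\<^sup>+x\<in>F. ?h x \<partial>lebesgue") (auto simp: ennreal_less_iff)
    \<comment> \<open>Dividing by \<open>m\<close> alone could enlarge the function: \<open>m\<close> may lie between \<open>1/3\<close> and \<open>1\<close>.\<close>
    define t where "t = max 1 m"
    have t: "1 \<le> t" "m \<le> t" "t \<le> 3 * m" using m by (auto simp: t_def)
    define f where "f x = indicator F x * (l powr (1 - enn2real (conj_exponent p x)) / t)" for x
    have [measurable]: "f \<in> borel_measurable lebesgue"
      unfolding f_def by measurable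
    have nonneg: "0 \<le> f x" for x
      using t by (simp add: f_def)
    have pw: "ennreal (\<bar>f x\<bar> powr enn2real (p x)) * indicator {x. p x \<noteq> \<infinity>} x
        \<le> ennreal (1 / t) * (?h x * indicator F x)" for x
    proof (cases "x \<in> F")
      case True
      then have x: "1 < p x" "p x < \<infinity>" using FS by auto
      then obtain P where P: "p x = ennreal P" "1 < P"
        by (rule ennreal_gt_1_finite_cases)
      then have P': "enn2real (conj_exponent p x) = P / (P - 1)"
        using conj_exponent_between[of p x, OF x] by simp
      have "\<bar>f x\<bar> = l powr (1 - P / (P - 1)) / t"
        using True t P' by (simp add: f_def)
      then have "\<bar>f x\<bar> powr P \<le> (1 / l) powr (P / (P - 1)) / t"
        using dual_exponent_power[OF P(2) l t(1)] by simp
      then show ?thesis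
        using True t P P' l by (simp flip: ennreal_mult)
    qed (simp add: f_def)
    have "(\<integral>\<^sup>+x\<in>{x. p x \<noteq> \<infinity>}. ennreal (\<bar>f x\<bar> powr enn2real (p x)) \<partial>lebesgue)
        \<le> (\<integral>\<^sup>+x. ennreal (1 / t) * (?h x * indicator F x) \<partial>lebesgue)"
      by (rule nn_integral_mono) (rule pw)
    also have "\<dots> = ennreal (1 / t) * ennreal m"
      by (subst nn_integral_cmult) (measurable, simp add: m)
    also have "\<dots> \<le> 1"
      using t m by (simp add: ennreal_1[symmetric] divide_le_eq del: ennreal_1 flip: ennreal_mult)
    finally have "(\<integral>\<^sup>+x\<in>{x. p x \<noteq> \<infinity>}. ennreal (\<bar>f x\<bar> powr enn2real (p x)) \<partial>lebesgue) \<le> 1" .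
    moreover have "Linf_norm (\<lambda>x. f x * indicator {x. p x = \<infinity>} x) \<le> 0"
    proof -
      have "f x * indicator {x. p x = \<infinity>} x = 0" for x
        using subsetD[OF FS, of x] by (cases "x \<in> F") (auto simp: f_def indicator_def)
      then show ?thesis
        by (intro Linf_norm_leI) simp_all
    qed
    ultimately have "modular p f \<le> 1"
      by (simp add: modular_def)
    moreover have "ennreal (l / 3) \<le> (\<integral>\<^sup>+x\<in>E. ennreal (f x) \<partial>lebesgue)"
    proof -
      \<comment> \<open>Against the indicator the test function reproduces the integrand of the conjugate modular, times \<open>l/t\<close>.\<close>
      have eq: "ennreal (l / t) * (?h x * indicator F x) = ennreal (f x) * indicator E x" for x
      proof (cases "x \<in> F")
        case True
        have "l * (1 / l) powr y = l powr (1 - y)" for y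
          using l by (simp add: powr_diff powr_divide)
        then have "l / t * (1 / l) powr y = l powr (1 - y) / t" for y
          by (metis times_divide_eq_left)
        then show ?thesis
          using True FS t l by (auto simp: f_def simp flip: ennreal_mult)
      qed (simp add: f_def)
      have "l / 3 \<le> l / t * m"
        using t l m by (simp add: field_simps)
      then have "ennreal (l / 3) \<le> ennreal (l / t) * ennreal m"
        using t l m by (simp flip: ennreal_mult)
      also have "\<dots> = (\<integral>\<^sup>+x. ennreal (l / t) * (?h x * indicator F x) \<partial>lebesgue)"
        by (subst nn_integral_cmult) (measurable, simp add: m)
      finally show ?thesis by (simp only: eq)
    qed
    ultimately show ?thesis
      using nonneg by (intro bexI[of _ f]) auto
  next
    case 2
    have I: "?I \<in> sets lebesgue" by measurable
    obtain m where m: "emeasure lebesgue ?I = ennreal m" "0 \<le> m"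
      using finite_part[of "{x. p x = \<infinity>}"] by (cases "emeasure lebesgue ?I") auto
    have "1 / 3 < 1 / l * m"
      using 2 l m by (simp add: ennreal_less_iff flip: ennreal_mult)
    then have "l / 3 \<le> m"
      using l by (simp add: field_simps)
    moreover have "(\<integral>\<^sup>+x\<in>E. ennreal (indicator ?I x) \<partial>lebesgue) = emeasure lebesgue ?I"
    proof -
      have "(\<integral>\<^sup>+x\<in>E. ennreal (indicator ?I x) \<partial>lebesgue) = (\<integral>\<^sup>+x. indicator ?I x \<partial>lebesgue)"
        by (rule nn_integral_cong) (auto simp: indicator_def)
      then show ?thesis using I by (simp only: nn_integral_indicator)
    qed
    moreover have "modular p (indicator ?I) \<le> 1"
    proof -
      have "(\<integral>\<^sup>+x\<in>{x. p x \<noteq> \<infinity>}. ennreal (\<bar>indicator ?I x\<bar> powr enn2real (p x)) \<partial>lebesgue)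
          = (\<integral>\<^sup>+x. 0 \<partial>(lebesgue :: (real ^ 'n) measure))"
        by (rule nn_integral_cong) (auto simp: indicator_def)
      moreover have "Linf_norm (\<lambda>x. indicator ?I x * indicator {x. p x = \<infinity>} x) \<le> 1"
        by (intro Linf_norm_leI) (measurable, auto simp: indicator_def)
      ultimately show ?thesis by (simp add: modular_def)
    qed
    ultimately show ?thesis
      using m I by (intro bexI[of _ "indicator ?I"]) (auto intro: ennreal_leI borel_measurable_indicator)
  next
    case 3
    have O: "?O \<in> sets lebesgue" by measurable
    \<comment> \<open>This part of the modular is \<open>0\<close> on a null set and \<open>1/l\<close> otherwise, so that \<open>l < 3\<close>.\<close>
    have notnull: "\<not> (AE x in lebesgue. x \<notin> ?O)"
    proof
      assume "AE x in lebesgue. x \<notin> ?O"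
      then have "AE x in lebesgue. ennreal \<bar>indicator ?O x / l\<bar> \<le> 0"
        by eventually_elim auto
      then have "?c \<le> 0"
        by (intro Linf_norm_leI) measurable
      with 3 show False by auto
    qed
    have "1 / 3 < 1 / l"
    proof (rule ccontr)
      assume "\<not> 1 / 3 < 1 / l"
      then have "?c \<le> ennreal (1 / 3)"
        using l by (intro Linf_norm_leI) (measurable, auto simp: indicator_def intro!: ennreal_leI)
      with 3 show False by auto
    qed
    then have l3: "l / 3 \<le> 1"
      using l by (simp add: field_simps)
    obtain m where m: "emeasure lebesgue ?O = ennreal m" "0 \<le> m"
      using finite_part[of "{x. p x = 1}"] by (cases "emeasure lebesgue ?O") auto
    have "m \<noteq> 0"
      using notnull m O AE_iff_measurable[of ?O lebesgue "\<lambda>x. x \<notin> ?O"] by auto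
    with m have m0: "0 < m" by simp
    have int: "(\<integral>\<^sup>+x. ennreal (1 / m) * indicator ?O x \<partial>lebesgue) = 1"
      using O m m0 by (subst nn_integral_cmult_indicator) (auto simp flip: ennreal_mult)
    define f where "f x = indicator ?O x / m" for x
    have "modular p f \<le> 1"
    proof -
      have "(\<integral>\<^sup>+x\<in>{x. p x \<noteq> \<infinity>}. ennreal (\<bar>f x\<bar> powr enn2real (p x)) \<partial>lebesgue)
          = (\<integral>\<^sup>+x. ennreal (1 / m) * indicator ?O x \<partial>lebesgue)"
        using m0 by (intro nn_integral_cong) (auto simp: f_def indicator_def)
      moreover have "Linf_norm (\<lambda>x. f x * indicator {x. p x = \<infinity>} x) \<le> 0"
        unfolding f_def by (intro Linf_norm_leI) (measurable, auto simp: indicator_def)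
      ultimately show ?thesis
        using int by (simp add: modular_def)
    qed
    moreover have "(\<integral>\<^sup>+x\<in>E. ennreal (f x) \<partial>lebesgue) = (\<integral>\<^sup>+x. ennreal (1 / m) * indicator ?O x \<partial>lebesgue)"
      by (intro nn_integral_cong) (auto simp: f_def indicator_def)
    moreover have "f \<in> borel_measurable lebesgue"
      unfolding f_def by measurable
    moreover have "0 \<le> f x" for x using m0 by (simp add: f_def)
    ultimately show ?thesis
      using l3 int by (intro bexI[of _ f]) (auto simp: ennreal_1[symmetric] simp del: ennreal_1)
  qed
qed

section \<open>Averaging operators\<close>

lemma measure_pos:
  fixes E :: "(real ^ 'n) set"
  assumes "0 < emeasure lebesgue E" "emeasure lebesgue E < \<infinity>"
  shows "0 < measure lebesgue E"
  using assms by (simp add: measure_def enn2real_positive_iff)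

lemma frac_avg_eq:
  assumes "0 < measure lebesgue E"
  shows "frac_avg \<alpha> E f = (\<lambda>x. (measure lebesgue E powr (\<alpha> / real CARD('n) - 1)
    * set_lebesgue_integral lebesgue E f) * indicator (E :: (real ^ 'n) set) x)"
  using assms by (simp add: frac_avg_def fun_eq_iff powr_diff)

text \<open>The operator has rank one: its value is a multiple of the indicator of \<open>E\<close>. Hence only the
  homogeneity of the norm of the target space enters, and boundedness reduces to that of the functional
  \<open>f \<mapsto> \<integral>\<^sub>E f\<close>.\<close>

lemma Lp_norm_frac_avg:
  fixes E :: "(real ^ 'n) set"
  assumes "0 < measure lebesgue E"
  shows "Lp_norm q (frac_avg \<alpha> E f) = ennreal (measure lebesgue E powr (\<alpha> / real CARD('n) - 1))
    * ennreal \<bar>set_lebesgue_integral lebesgue E f\<bar> * Lp_norm q (indicator E)"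
  unfolding frac_avg_eq[OF assms] Lp_norm_cmult
  by (simp add: abs_mult ennreal_mult)

lemma indicator_Lp_space:
  assumes "E \<in> sets lebesgue" "{x. r x = \<infinity>} \<in> sets lebesgue" "emeasure lebesgue E < \<infinity>"
  shows "indicator E \<in> Lp_space r"
  using cmult_indicator_Lp_space[OF assms, of 1] by simp

text \<open>The expression whose supremum over the family is \<^const>\<open>K0_const\<close>.\<close>

definition K0_term ::
  "real \<Rightarrow> (real ^ 'n) set \<Rightarrow> (real ^ 'n \<Rightarrow> ennreal) \<Rightarrow> (real ^ 'n \<Rightarrow> ennreal) \<Rightarrow> ennreal" where
  "K0_term \<alpha> E p q = ennreal (measure lebesgue E powr (\<alpha> / real CARD('n) - 1))
    * Lp_norm (conj_exponent p) (indicator E) * Lp_norm q (indicator E)"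

lemma set_integral_le_Lp_norm:
  fixes p :: "real ^ 'n \<Rightarrow> ennreal"
  assumes p: "p \<in> exponents" and f: "f \<in> Lp_space p"
    and E[measurable]: "E \<in> sets lebesgue" and fin: "emeasure lebesgue E < \<infinity>"
  shows "(\<integral>\<^sup>+x\<in>E. ennreal \<bar>f x\<bar> \<partial>lebesgue)
      \<le> holder_const p * Lp_norm p f * Lp_norm (conj_exponent p) (indicator E)" (is ?le)
    and "set_integrable lebesgue E f" (is ?int)
    and "ennreal \<bar>set_lebesgue_integral lebesgue E f\<bar>
      \<le> holder_const p * Lp_norm p f * Lp_norm (conj_exponent p) (indicator E)" (is ?le')
proof -
  note p' = conj_exponent_exponents[OF p]
  note [measurable] = Lp_space_measurable[OF f]
  have E': "indicator E \<in> Lp_space (conj_exponent p)"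
    using exponents_level_sets(1)[OF exponents_measurable[OF p']] E fin by (intro indicator_Lp_space)
  have "(\<integral>\<^sup>+x\<in>E. ennreal \<bar>f x\<bar> \<partial>lebesgue) = (\<integral>\<^sup>+x. ennreal \<bar>f x * indicator E x\<bar> \<partial>lebesgue)"
    by (rule nn_integral_cong) (simp add: indicator_def)
  then show le: ?le
    using holder_Lp_norm[OF p f E'] by simp
  also have "holder_const p * Lp_norm p f * Lp_norm (conj_exponent p) (indicator E) < \<infinity>"
    using Lp_norm_finite[OF p f] Lp_norm_finite[OF p' E'] holder_const_le_4[OF p]
    by (auto simp: ennreal_mult_less_top order_le_less_trans)
  finally have "(\<integral>\<^sup>+x\<in>E. ennreal \<bar>f x\<bar> \<partial>lebesgue) < \<infinity>" .
  also have eq: "(\<integral>\<^sup>+x\<in>E. ennreal \<bar>f x\<bar> \<partial>lebesgue) = (\<integral>\<^sup>+x. ennreal (norm (indicator E x *\<^sub>R f x)) \<partial>lebesgue)"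
    by (rule nn_integral_cong) (simp add: indicator_def)
  finally show int: ?int
    unfolding set_integrable_def by (intro integrableI_bounded) measurable
  have "ennreal \<bar>set_lebesgue_integral lebesgue E f\<bar> \<le> (\<integral>\<^sup>+x. ennreal (norm (indicator E x *\<^sub>R f x)) \<partial>lebesgue)"
    using integral_norm_bound_ennreal[OF int[unfolded set_integrable_def]]
    by (simp add: set_lebesgue_integral_def)
  then show ?le'
    using le eq by simp
qed

lemma Lp_norm_frac_avg_le:
  fixes p :: "real ^ 'n \<Rightarrow> ennreal"
  assumes p: "p \<in> exponents" and f: "f \<in> Lp_space p"
    and E: "E \<in> sets lebesgue" "0 < emeasure lebesgue E" "emeasure lebesgue E < \<infinity>"
  shows "Lp_norm q (frac_avg \<alpha> E f) \<le> holder_const p * K0_term \<alpha> E p q * Lp_norm p f"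
proof -
  have "Lp_norm q (frac_avg \<alpha> E f) \<le> ennreal (measure lebesgue E powr (\<alpha> / real CARD('n) - 1))
      * (holder_const p * Lp_norm p f * Lp_norm (conj_exponent p) (indicator E)) * Lp_norm q (indicator E)"
    unfolding Lp_norm_frac_avg[OF measure_pos[OF E(2,3)]]
    by (intro mult_right_mono mult_left_mono set_integral_le_Lp_norm[OF p f E(1,3)]) auto
  then show ?thesis
    by (simp add: K0_term_def mult_ac)
qed

text \<open>Each \<open>l\<close> below the conjugate norm of the indicator of \<open>E\<close> has a test function in the unit ball with integral
  at least \<open>l/3\<close>; the assumed bound at this function estimates the expression with \<open>l\<close> in place of the norm. Then
  \<open>l\<close> tends to the norm.\<close>

lemma K0_term_le:
  fixes p :: "real ^ 'n \<Rightarrow> ennreal"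
  assumes p: "p \<in> exponents"
    and E: "E \<in> sets lebesgue" "0 < emeasure lebesgue E" "emeasure lebesgue E < \<infinity>"
    and bound: "\<And>f. f \<in> Lp_space p \<Longrightarrow> Lp_norm q (frac_avg \<alpha> E f) \<le> C * Lp_norm p f"
  shows "K0_term \<alpha> E p q \<le> 3 * C"
proof -
  note p' = conj_exponent_exponents[OF p]
  let ?w = "ennreal (measure lebesgue E powr (\<alpha> / real CARD('n) - 1))"
  let ?N = "Lp_norm (conj_exponent p) (indicator E)" and ?Q = "Lp_norm q (indicator E)"
  have E': "indicator E \<in> Lp_space (conj_exponent p)"
    using exponents_level_sets(1)[OF exponents_measurable[OF p']] E by (intro indicator_Lp_space)
  obtain N where N: "?N = ennreal N" "0 \<le> N"
    using Lp_norm_finite[OF p' E'] by (cases ?N) auto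
  have below: "?w * ennreal l * ?Q \<le> 3 * C" if l: "0 < l" "l < N" for l
  proof -
    have "\<not> modular (conj_exponent p) (\<lambda>x. indicator E x / l) \<le> 1"
    proof
      assume "modular (conj_exponent p) (\<lambda>x. indicator E x / l) \<le> 1"
      then have "?N \<le> ennreal l" using l by (intro Lp_norm_leI)
      with l N show False by simp
    qed
    then obtain f where f: "f \<in> borel_measurable lebesgue" "\<And>x. 0 \<le> f x" "modular p f \<le> 1"
        "ennreal (l / 3) \<le> (\<integral>\<^sup>+x\<in>E. ennreal (f x) \<partial>lebesgue)"
      using dual_test_function[OF p E(1,3) l(1)] by blast
    have norm_f: "Lp_norm p f \<le> 1"
      using Lp_norm_leI[of 1 p f] f(3) by simp
    have "modular p (\<lambda>x. f x / 1) < \<infinity>"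
      using f(3) by (simp add: order_le_less_trans)
    then have fLp: "f \<in> Lp_space p"
      unfolding Lp_space_def mem_Collect_eq using f(1) zero_less_one by blast
    have int: "integrable lebesgue (\<lambda>x. indicator E x *\<^sub>R f x)"
      using set_integral_le_Lp_norm(2)[OF p fLp E(1,3)] by (simp add: set_integrable_def)
    have "(\<integral>\<^sup>+x\<in>E. ennreal (f x) \<partial>lebesgue) = (\<integral>\<^sup>+x. ennreal (indicator E x *\<^sub>R f x) \<partial>lebesgue)"
      by (rule nn_integral_cong) (simp add: indicator_def)
    also have "\<dots> = ennreal (set_lebesgue_integral lebesgue E f)"
      using f(2) by (subst nn_integral_eq_integral[OF int]) (auto simp: set_lebesgue_integral_def)
    also have "\<dots> \<le> ennreal \<bar>set_lebesgue_integral lebesgue E f\<bar>"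
      by (intro ennreal_leI) simp
    finally have "ennreal (l / 3) \<le> ennreal \<bar>set_lebesgue_integral lebesgue E f\<bar>"
      using f(4) by (rule order_trans[rotated])
    then have "?w * ennreal (l / 3) * ?Q \<le> Lp_norm q (frac_avg \<alpha> E f)"
      unfolding Lp_norm_frac_avg[OF measure_pos[OF E(2,3)]]
      by (intro mult_right_mono mult_left_mono) auto
    also have "\<dots> \<le> C * Lp_norm p f"
      by (rule bound[OF fLp])
    also have "\<dots> \<le> C * 1"
      using norm_f by (intro mult_left_mono) auto
    finally have "3 * (?w * ennreal (l / 3) * ?Q) \<le> 3 * C"
      by (intro mult_left_mono) auto
    moreover have "3 * ennreal (l / 3) = ennreal l"
      using l by (simp add: ennreal_mult[symmetric] flip: ennreal_numeral)
    moreover have "3 * (?w * ennreal (l / 3) * ?Q) = ?w * (3 * ennreal (l / 3)) * ?Q"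
      by (simp only: mult_ac)
    ultimately show ?thesis
      by simp
  qed
  show ?thesis
  proof (cases "N = 0")
    case True
    then show ?thesis using N by (simp add: K0_term_def)
  next
    case False
    show ?thesis
    proof (rule ennreal_approx_unit)
      fix a :: ennreal assume a: "0 < a" "a < 1"
      then obtain r where r: "a = ennreal r" "0 < r" "r < 1"
        by (cases a) (auto simp: ennreal_less_iff ennreal_1[symmetric] simp del: ennreal_1)
      have "?w * ennreal (r * N) * ?Q \<le> 3 * C"
        using r N False by (intro below) auto
      then show "a * K0_term \<alpha> E p q \<le> 3 * C"
        using r N by (simp add: K0_term_def ennreal_mult mult_ac)
    qed
  qed
qed

text \<open>Where \<open>q = \<infinity>\<close> the defining relation forces \<open>p = n/\<alpha>\<close>, which is excluded by \<open>p\<^sub>+ < n/\<alpha>\<close>.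
  For \<open>\<alpha> = 0\<close> this reads \<open>p = \<infinity>\<close> and \<open>p\<^sub>+ < \<infinity>\<close>.\<close>

lemma AE_target_exponent_finite:
  fixes p q :: "real ^ 'n \<Rightarrow> ennreal"
  assumes "0 \<le> \<alpha>"
    and plus: "p_plus p < ennreal (real CARD('n)) / ennreal \<alpha>"
    and pq: "AE x in lebesgue.
           1 / enn2ereal (p x) - 1 / enn2ereal (q x) = ereal (\<alpha> / real CARD('n))"
  shows "AE x in lebesgue. q x \<noteq> \<infinity>"
  using AE_le_p_plus[of p] pq
proof eventually_elim
  case (elim x)
  have lt: "p x < ennreal (real CARD('n)) / ennreal \<alpha>"
    using elim(1) plus by (rule order_le_less_trans)
  show ?case
  proof
    assume "q x = \<infinity>"
    then have eq: "1 / enn2ereal (p x) = ereal (\<alpha> / real CARD('n))"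
      using elim(2) by (simp add: top_ereal_def)
    obtain P where P: "p x = ennreal P" "0 \<le> P"
      using lt by (cases "p x") auto
    then have "0 < P" and "1 / P = \<alpha> / real CARD('n)"
      using eq by (auto simp: divide_ereal_def one_ereal_def inverse_eq_divide split: if_splits)
    have "0 < \<alpha>"
    proof (rule ccontr)
      assume "\<not> 0 < \<alpha>"
      then have "\<alpha> = 0" using \<open>0 \<le> \<alpha>\<close> by simp
      with \<open>0 < P\<close> \<open>1 / P = \<alpha> / real CARD('n)\<close> show False by simp
    qed
    then have "P = real CARD('n) / \<alpha>"
      using \<open>0 < P\<close> \<open>1 / P = \<alpha> / real CARD('n)\<close>
      by (simp add: field_simps)
    then show False
      using lt P \<open>0 < \<alpha>\<close> by (simp add: divide_ennreal)
  qed
qed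

text \<open>The exponent \<open>q\<close> is given only almost everywhere. Completeness of the Lebesgue measure makes the set where it is
  infinite measurable, without which the essential supremum in the modular would take its default value.\<close>

lemma level_set_infinity_lebesgue:
  assumes "AE x in (lebesgue :: (real ^ 'n) measure). q x \<noteq> (\<infinity> :: ennreal)"
  shows "{x. q x = \<infinity>} \<in> sets lebesgue"
proof -
  obtain N where N: "{x \<in> space (lebesgue :: (real ^ 'n) measure). \<not> q x \<noteq> \<infinity>} \<subseteq> N" "N \<in> null_sets lebesgue"
    using assms unfolding eventually_ae_filter by blast
  have "{x. q x = \<infinity>} \<subseteq> N"
    using N(1) by simp
  then have "{x. q x = \<infinity>} \<in> null_sets lebesgue"
    using N(2) by (rule null_sets_completion_subset)
  then show ?thesis by (rule null_setsD2)
qed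

theorem proposition3p5:
  fixes \<alpha> :: real
    and p q :: "real ^ 'n \<Rightarrow> ennreal"
    and \<E> :: "(real ^ 'n) set set"
  assumes "0 \<le> \<alpha>" and "\<alpha> < real CARD('n)"
    and "p \<in> exponents"
    and "p_plus p < ennreal (real CARD('n)) / ennreal \<alpha>"
    and "AE x in lebesgue.
           1 / enn2ereal (p x) - 1 / enn2ereal (q x) = ereal (\<alpha> / real CARD('n))"
    and "\<And>E. E \<in> \<E> \<Longrightarrow> E \<in> sets lebesgue \<and> 0 < emeasure lebesgue E \<and> emeasure lebesgue E < \<infinity>"
  shows "(K0_const \<alpha> \<E> p q < \<infinity> \<longleftrightarrow>
           (\<forall>E\<in>\<E>. frac_avg_maps \<alpha> E p q) \<and>
           (\<exists>C::real. \<forall>E\<in>\<E>. \<forall>f\<in>Lp_space p.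
              Lp_norm q (frac_avg \<alpha> E f) \<le> ennreal C * Lp_norm p f)) \<and>
         (SUP E\<in>\<E>. op_norm p q (frac_avg \<alpha> E)) \<le> holder_const p * K0_const \<alpha> \<E> p q \<and>
         holder_const p * K0_const \<alpha> \<E> p q \<le> 4 * K0_const \<alpha> \<E> p q"
proof -
  note p = \<open>p \<in> exponents\<close>
  have E: "E \<in> sets lebesgue" "0 < emeasure lebesgue E" "emeasure lebesgue E < \<infinity>" if "E \<in> \<E>" for E
    using assms(6)[OF that] by auto
  have K0: "K0_const \<alpha> \<E> p q = (SUP E\<in>\<E>. K0_term \<alpha> E p q)"
    by (simp add: K0_const_def K0_term_def)
  have bound: "Lp_norm q (frac_avg \<alpha> E f) \<le> holder_const p * K0_const \<alpha> \<E> p q * Lp_norm p f"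
    if "E \<in> \<E>" "f \<in> Lp_space p" for E f
  proof -
    have "Lp_norm q (frac_avg \<alpha> E f) \<le> holder_const p * K0_term \<alpha> E p q * Lp_norm p f"
      by (rule Lp_norm_frac_avg_le[OF p that(2) E[OF that(1)]])
    also have "\<dots> \<le> holder_const p * K0_const \<alpha> \<E> p q * Lp_norm p f"
      unfolding K0 using that by (intro mult_right_mono mult_left_mono SUP_upper) auto
    finally show ?thesis .
  qed
  have q: "{x. q x = \<infinity>} \<in> sets lebesgue"
    using AE_target_exponent_finite[OF assms(1,4,5)] by (rule level_set_infinity_lebesgue)
  have maps: "frac_avg_maps \<alpha> E p q" if "E \<in> \<E>" for E
    unfolding frac_avg_maps_def
  proof (intro ballI conjI)
    fix f assume f: "f \<in> Lp_space p"
    show "set_integrable lebesgue E f"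
      by (rule set_integral_le_Lp_norm(2)[OF p f E(1,3)[OF that]])
    show "frac_avg \<alpha> E f \<in> Lp_space q"
      unfolding frac_avg_eq[OF measure_pos[OF E(2,3)[OF that]]]
      by (rule cmult_indicator_Lp_space[OF E(1)[OF that] q E(3)[OF that]])
  qed
  have iff: "K0_const \<alpha> \<E> p q < \<infinity> \<longleftrightarrow>
      (\<exists>C::real. \<forall>E\<in>\<E>. \<forall>f\<in>Lp_space p. Lp_norm q (frac_avg \<alpha> E f) \<le> ennreal C * Lp_norm p f)"
  proof
    assume fin: "K0_const \<alpha> \<E> p q < \<infinity>"
    have "holder_const p < \<infinity>"
      using holder_const_le_4[OF p] by (auto simp: order_le_less_trans)
    with fin have "holder_const p * K0_const \<alpha> \<E> p q < \<infinity>"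
      by (simp add: ennreal_mult_less_top)
    then obtain C where "holder_const p * K0_const \<alpha> \<E> p q = ennreal C"
      by (cases "holder_const p * K0_const \<alpha> \<E> p q") auto
    with bound show "\<exists>C::real. \<forall>E\<in>\<E>. \<forall>f\<in>Lp_space p. Lp_norm q (frac_avg \<alpha> E f) \<le> ennreal C * Lp_norm p f"
      by (intro exI[of _ C]) simp
  next
    assume "\<exists>C::real. \<forall>E\<in>\<E>. \<forall>f\<in>Lp_space p. Lp_norm q (frac_avg \<alpha> E f) \<le> ennreal C * Lp_norm p f"
    then obtain C :: real where C:
      "\<And>E f. E \<in> \<E> \<Longrightarrow> f \<in> Lp_space p \<Longrightarrow> Lp_norm q (frac_avg \<alpha> E f) \<le> ennreal C * Lp_norm p f"
      by auto
    have "K0_const \<alpha> \<E> p q \<le> 3 * ennreal C"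
      unfolding K0 using K0_term_le[OF p E C] by (intro SUP_least)
    then show "K0_const \<alpha> \<E> p q < \<infinity>"
      by (rule order_le_less_trans) (simp add: ennreal_mult_less_top)
  qed
  have "(SUP E\<in>\<E>. op_norm p q (frac_avg \<alpha> E)) \<le> holder_const p * K0_const \<alpha> \<E> p q"
    unfolding op_norm_def using bound by (intro SUP_least Inf_lower) auto
  moreover have "holder_const p * K0_const \<alpha> \<E> p q \<le> 4 * K0_const \<alpha> \<E> p q"
    by (intro mult_right_mono holder_const_le_4[OF p]) auto
  ultimately show ?thesis
    using iff maps by blast
qed

end
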